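(* Every LVMQ manifold is $2$-connected: if $m\ge1$ and $\Lambda=(\lambda_1,\ldots,\lambda_n)\subset\mathbb{R}^{4m}$ is an admissible configuration whose affine span is $\mathbb{R}^{4m}$, then $N_{\mathbb H}(\Lambda)$ is $2$-connected.
   Context: $\mathbb{H}$ denotes the quaternions and $\operatorname{Sp}(1)$ the unit quaternions. A configuration $\Lambda=(\lambda_1,\ldots,\lambda_n)\subset\mathbb{R}^{4m}$ is admissible if $0\in\operatorname{conv}\{\lambda_1,\ldots,\lambda_n\}$ and, for every $I\subset\{1,\ldots,n\}$, $0\in\operatorname{conv}\{\lambda_i:i\in I\}$ implies $|I|>4m$. Define $$Z_{\mathbb H}(\Lambda)=\Big\{q\in\mathbb{H}^n:\ \sum_i\lambda_i|q_i|^2=0,\ \sum_i|q_i|^2=1\Big\},$$ a compact smooth manifold on which $\operatorname{Sp}(1)$ acts freely by diagonal left multiplication $a\cdot(q_1,\ldots,q_n)=(aq_1,\ldots,aq_n)$. The LVMQ manifold associated with $\Lambda$ is $N_{\mathbb H}(\Lambda)=Z_{\mathbb H}(\Lambda)/\operatorname{Sp}(1)$. *)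

theory Defs
  imports "HOL-Analysis.Analysis"
begin

section \<open>Quaternions\<close>

text \<open>\<open>Quat a b c d\<close> is \<open>a + b i + c j + d k\<close>, with \<open>i\<^sup>2 = j\<^sup>2 = k\<^sup>2 = i j k = -1\<close>.\<close>

codatatype quat = Quat (qRe: real) (qI: real) (qJ: real) (qK: real)

lemma quat_eq_iff:
  "x = y \<longleftrightarrow> qRe x = qRe y \<and> qI x = qI y \<and> qJ x = qJ y \<and> qK x = qK y"
  by (auto intro: quat.expand)

instantiation quat :: real_vector
begin

primcorec zero_quat where
  "qRe 0 = 0" | "qI 0 = 0" | "qJ 0 = 0" | "qK 0 = 0"

primcorec plus_quat where
  "qRe (x + y) = qRe x + qRe y"
| "qI (x + y) = qI x + qI y"
| "qJ (x + y) = qJ x + qJ y"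
| "qK (x + y) = qK x + qK y"

primcorec uminus_quat where
  "qRe (- x) = - qRe x" | "qI (- x) = - qI x" | "qJ (- x) = - qJ x" | "qK (- x) = - qK x"

primcorec minus_quat where
  "qRe (x - y) = qRe x - qRe y"
| "qI (x - y) = qI x - qI y"
| "qJ (x - y) = qJ x - qJ y"
| "qK (x - y) = qK x - qK y"

primcorec scaleR_quat where
  "qRe (scaleR r x) = r * qRe x"
| "qI (scaleR r x) = r * qI x"
| "qJ (scaleR r x) = r * qJ x"
| "qK (scaleR r x) = r * qK x"

instance
  by standard (simp_all add: quat_eq_iff algebra_simps)

end

instantiation quat :: real_algebra_1
begin

primcorec one_quat where
  "qRe 1 = 1" | "qI 1 = 0" | "qJ 1 = 0" | "qK 1 = 0"

primcorec times_quat where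
  "qRe (x * y) = qRe x * qRe y - qI x * qI y - qJ x * qJ y - qK x * qK y"
| "qI (x * y) = qRe x * qI y + qI x * qRe y + qJ x * qK y - qK x * qJ y"
| "qJ (x * y) = qRe x * qJ y - qI x * qK y + qJ x * qRe y + qK x * qI y"
| "qK (x * y) = qRe x * qK y + qI x * qJ y - qJ x * qI y + qK x * qRe y"

instance
  by standard (simp_all add: quat_eq_iff algebra_simps)

end

instantiation quat :: real_inner
begin

definition inner_quat :: "quat \<Rightarrow> quat \<Rightarrow> real" where
  "inner_quat x y = qRe x * qRe y + qI x * qI y + qJ x * qJ y + qK x * qK y"

definition norm_quat :: "quat \<Rightarrow> real" where
  "norm_quat x = sqrt ((qRe x)\<^sup>2 + (qI x)\<^sup>2 + (qJ x)\<^sup>2 + (qK x)\<^sup>2)"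

definition sgn_quat :: "quat \<Rightarrow> quat" where
  "sgn_quat x = x /\<^sub>R norm x"

definition dist_quat :: "quat \<Rightarrow> quat \<Rightarrow> real" where
  "dist_quat x y = norm (x - y)"

definition uniformity_quat :: "(quat \<times> quat) filter" where
  "uniformity_quat = (INF e\<in>{0<..}. principal {(x, y). dist x y < e})"

definition open_quat :: "quat set \<Rightarrow> bool" where
  "open_quat U \<longleftrightarrow> (\<forall>x\<in>U. \<forall>\<^sub>F (x', y) in uniformity. x' = x \<longrightarrow> y \<in> U)"

instance
proof
  fix x y z :: quat and r :: real and U :: "quat set"
  show "sgn x = x /\<^sub>R norm x" by (rule sgn_quat_def)
  show "dist x y = norm (x - y)" by (rule dist_quat_def)
  show "(uniformity :: (quat \<times> quat) filter) = (INF e\<in>{0<..}. principal {(x, y). dist x y < e})"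
    by (rule uniformity_quat_def)
  show "open U \<longleftrightarrow> (\<forall>x\<in>U. \<forall>\<^sub>F (x', y) in uniformity. x' = x \<longrightarrow> y \<in> U)"
    by (rule open_quat_def)
  show "inner x y = inner y x" by (simp add: inner_quat_def mult.commute)
  show "inner (x + y) z = inner x z + inner y z" by (simp add: inner_quat_def algebra_simps)
  show "inner (scaleR r x) y = r * inner x y" by (simp add: inner_quat_def algebra_simps)
  show "0 \<le> inner x x" by (simp add: inner_quat_def)
  show "inner x x = 0 \<longleftrightarrow> x = 0"
    by (simp add: inner_quat_def quat_eq_iff add_nonneg_eq_0_iff)
  show "norm x = sqrt (inner x x)"
    by (simp add: inner_quat_def norm_quat_def power2_eq_square)
qed

end

instantiation quat :: real_normed_div_algebra
begin

primcorec inverse_quat where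
  "qRe (inverse x) = qRe x / (norm x)\<^sup>2"
| "qI (inverse x) = - qI x / (norm x)\<^sup>2"
| "qJ (inverse x) = - qJ x / (norm x)\<^sup>2"
| "qK (inverse x) = - qK x / (norm x)\<^sup>2"

definition "x div y = x * inverse y" for x y :: quat

instance
proof
  fix x y :: quat
  have n2: "(norm z)\<^sup>2 = qRe z * qRe z + qI z * qI z + qJ z * qJ z + qK z * qK z" for z :: quat
    by (simp add: norm_quat_def power2_eq_square)
  show "x div y = x * inverse y" by (rule divide_quat_def)
  show "inverse (0 :: quat) = 0" by (simp add: quat_eq_iff)
  define c where "c = Quat (qRe x) (- qI x) (- qJ x) (- qK x)"
  have inv: "inverse x = (1 / (norm x)\<^sup>2) *\<^sub>R c"
    by (simp add: quat_eq_iff c_def)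
  have c: "c * x = (norm x)\<^sup>2 *\<^sub>R 1" "x * c = (norm x)\<^sup>2 *\<^sub>R 1"
    unfolding n2 by (simp_all add: quat_eq_iff c_def)
  show "inverse x * x = 1" "x * inverse x = 1" if "x \<noteq> 0"
    using that by (simp_all add: inv c)
  have "(norm (x * y))\<^sup>2 = (norm x * norm y)\<^sup>2"
    unfolding power_mult_distrib n2 by (simp add: algebra_simps)
  then show "norm (x * y) = norm x * norm y"
    by simp
qed

end


section \<open>Quotient topology\<close>

definition quotient_topology :: "'a topology \<Rightarrow> ('a \<Rightarrow> 'b) \<Rightarrow> 'b topology" where
  "quotient_topology X p =
     topology (\<lambda>U. U \<subseteq> p ` topspace X \<and> openin X {x \<in> topspace X. p x \<in> U})"

lemma openin_quotient_topology:
  "openin (quotient_topology X p) U \<longleftrightarrow>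
     U \<subseteq> p ` topspace X \<and> openin X {x \<in> topspace X. p x \<in> U}"
proof -
  have Int: "{x \<in> topspace X. p x \<in> S \<inter> T} =
      {x \<in> topspace X. p x \<in> S} \<inter> {x \<in> topspace X. p x \<in> T}" for S T
    by auto
  have Union: "{x \<in> topspace X. p x \<in> \<Union>\<K>} = (\<Union>K\<in>\<K>. {x \<in> topspace X. p x \<in> K})" for \<K>
    by auto
  have "istopology (\<lambda>U. U \<subseteq> p ` topspace X \<and> openin X {x \<in> topspace X. p x \<in> U})"
    unfolding istopology_def Int Union by (auto intro: openin_Int)
  then show ?thesis
    by (simp add: quotient_topology_def)
qed

lemma topspace_quotient_topology: "topspace (quotient_topology X p) = p ` topspace X"
proof
  show "topspace (quotient_topology X p) \<subseteq> p ` topspace X"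
    using openin_topspace [of "quotient_topology X p"]
    unfolding openin_quotient_topology by (rule conjunct1)
  have "{x \<in> topspace X. p x \<in> p ` topspace X} = topspace X"
    by auto
  then have "openin (quotient_topology X p) (p ` topspace X)"
    by (simp add: openin_quotient_topology)
  then show "p ` topspace X \<subseteq> topspace (quotient_topology X p)"
    by (rule openin_subset)
qed

lemma quotient_map_quotient_topology: "quotient_map X (quotient_topology X p) p"
  by (auto simp: quotient_map_def topspace_quotient_topology openin_quotient_topology)


section \<open>Homotopy groups and n-connectedness\<close>

definition cube :: "nat \<Rightarrow> (nat \<Rightarrow> real) topology" where
  "cube k = product_topology (\<lambda>_. top_of_set {0..1}) {..<k}"

definition cube_boundary :: "nat \<Rightarrow> (nat \<Rightarrow> real) set" where
  "cube_boundary k = {t \<in> topspace (cube k). \<exists>i<k. t i = 0 \<or> t i = 1}"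

definition based_maps :: "nat \<Rightarrow> 'a topology \<Rightarrow> 'a \<Rightarrow> ((nat \<Rightarrow> real) \<Rightarrow> 'a) set" where
  "based_maps k X x = {f. continuous_map (cube k) X f \<and> (\<forall>t\<in>cube_boundary k. f t = x)}"

text \<open>
  The underlying set of \<open>\<pi>\<^sub>k(X, x)\<close>; its group structure plays no role in deciding
  whether \<open>\<pi>\<^sub>k(X, x)\<close> is trivial. The maps are total functions, but their
  values outside the cube are irrelevant: \<open>homotopic_with\<close> relates any two maps that agree on it.
\<close>

definition homotopy_group_set ::
    "nat \<Rightarrow> 'a topology \<Rightarrow> 'a \<Rightarrow> ((nat \<Rightarrow> real) \<Rightarrow> 'a) set set" where
  "homotopy_group_set k X x = based_maps k X x //
     {(f, g). f \<in> based_maps k X x \<and> g \<in> based_maps k X x \<and>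
              homotopic_with (\<lambda>h. \<forall>t\<in>cube_boundary k. h t = x) (cube k) X f g}"

definition n_connected_space :: "nat \<Rightarrow> 'a topology \<Rightarrow> bool" where
  "n_connected_space n X \<longleftrightarrow>
     topspace X \<noteq> {} \<and> path_connected_space X \<and>
     (\<forall>k\<in>{1..n}. \<forall>x\<in>topspace X. is_singleton (homotopy_group_set k X x))"


section \<open>LVMQ manifolds\<close>

text \<open>
  Configurations are families indexed by a finite type \<open>'n\<close>, so that \<open>card I\<close> counts indices
  (the \<open>\<lambda>\<^sub>i\<close> need not be distinct a priori).
\<close>

definition admissible :: "nat \<Rightarrow> ('n::finite \<Rightarrow> real ^ 'd) \<Rightarrow> bool" where
  "admissible m \<Lambda> \<longleftrightarrow>
     0 \<in> convex hull (range \<Lambda>) \<and>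
     (\<forall>I. 0 \<in> convex hull (\<Lambda> ` I) \<longrightarrow> 4 * m < card I)"

definition Z_H :: "('n::finite \<Rightarrow> real ^ 'd) \<Rightarrow> (quat ^ 'n) set" where
  "Z_H \<Lambda> = {q. (\<Sum>i\<in>UNIV. (norm (q $ i))\<^sup>2 *\<^sub>R \<Lambda> i) = 0 \<and> (\<Sum>i\<in>UNIV. (norm (q $ i))\<^sup>2) = 1}"

definition Sp1 :: "quat set" where
  "Sp1 = {a. norm a = 1}"

definition Sp1_orbit :: "quat ^ 'n::finite \<Rightarrow> (quat ^ 'n) set" where
  "Sp1_orbit q = {a *s q | a. a \<in> Sp1}"

definition N_H :: "('n::finite \<Rightarrow> real ^ 'd) \<Rightarrow> (quat ^ 'n) set topology" where
  "N_H \<Lambda> = quotient_topology (top_of_set (Z_H \<Lambda>)) Sp1_orbit"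

end

theory Submission
  imports Defs
begin

text \<open>
  A point of \<open>Z\<^sub>H\<close> consists of squared moduli in a convex polytope and of phases in
  \<open>Sp(1)\<close>, the latter only where the modulus is nonzero. The quaternions have real dimension 4,
  so a quaternion-valued map on a compact subset of a space of dimension at most 3 extends to the
  whole space without acquiring new zeros; together with an extension of the moduli inside the
  polytope this extends every map from such a set to \<open>Z\<^sub>H\<close>. In particular \<open>Z\<^sub>H\<close> is
  2-connected, whatever the polytope, as long as it is nonempty. A map of a square into the quotient
  lifts to \<open>Z\<^sub>H\<close>, and since \<open>Sp(1)\<close> is a 3-sphere, the lift can be made constant on the
  boundary.
\<close>


section \<open>Extending maps without introducing zeros\<close>

text \<open>A Lipschitz bound at the single centre \<open>x\<close>. This is the local hypothesis
  under which negligible sets have negligible images, and it survives division by a positive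
  function.\<close>

definition calm_at :: "('a::real_normed_vector \<Rightarrow> 'b::real_normed_vector) \<Rightarrow> 'a \<Rightarrow> bool" where
  "calm_at f x \<longleftrightarrow> (\<exists>T B. open T \<and> x \<in> T \<and> (\<forall>y\<in>T. norm (f y - f x) \<le> B * norm (y - x)))"

lemma calm_at_divide:
  fixes f :: "'a::real_normed_vector \<Rightarrow> 'b::real_normed_vector"
  assumes "calm_at f x" "calm_at u x" "continuous_on UNIV u" "u x > (0::real)"
  shows "calm_at (\<lambda>y. f y /\<^sub>R u y) x"
proof -
  obtain S B where S: "open S" "x \<in> S" "\<And>y. y \<in> S \<Longrightarrow> norm (f y - f x) \<le> B * norm (y - x)"
    using assms(1) by (auto simp: calm_at_def)
  obtain T C where T: "open T" "x \<in> T" "\<And>y. y \<in> T \<Longrightarrow> norm (u y - u x) \<le> C * norm (y - x)"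
    using assms(2) by (auto simp: calm_at_def)
  define V where "V = S \<inter> T \<inter> {y. u x / 2 < u y}"
  have "open V"
    unfolding V_def using S T assms(3) by (intro open_Int open_Collect_less continuous_intros) auto
  moreover have "x \<in> V"
    using S T assms(4) by (auto simp: V_def)
  moreover have "norm (f y /\<^sub>R u y - f x /\<^sub>R u x)
      \<le> (2 * B / u x + 2 * norm (f x) * C / (u x)\<^sup>2) * norm (y - x)" if "y \<in> V" for y
  proof -
    have y: "y \<in> S" "y \<in> T" "u x / 2 < u y" "u y > 0"
      using that assms(4) by (auto simp: V_def)
    have inv: "1 / u y \<le> 2 / u x"
      using y assms(4) by (simp add: field_simps)
    \<comment> \<open>The numerator varies under the factor \<open>1 / u y\<close>, which is bounded
      near \<open>x\<close>; then the reciprocal varies against the fixed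
      \<open>f x\<close>.\<close>
    have eq: "f y /\<^sub>R u y - f x /\<^sub>R u x = (1 / u y) *\<^sub>R (f y - f x) + ((u x - u y) * (1 / u y) * (1 / u x)) *\<^sub>R f x"
      using y assms(4) by (simp add: scaleR_diff_right field_simps flip: scaleR_left_distrib scaleR_left_diff_distrib)
    have 1: "norm ((1 / u y) *\<^sub>R (f y - f x)) \<le> (2 / u x) * (B * norm (y - x))"
      unfolding norm_scaleR using y assms(4) inv S(3)[OF y(1)] by (intro mult_mono) auto
    have 2: "norm (((u x - u y) * (1 / u y) * (1 / u x)) *\<^sub>R f x)
        \<le> ((C * norm (y - x)) * (2 / u x) * (1 / u x)) * norm (f x)"
      unfolding norm_scaleR abs_mult using y assms(4) inv T(3)[OF y(2)]
      by (intro mult_right_mono mult_mono) (auto simp: abs_minus_commute intro: order_trans[OF abs_ge_zero])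
    show ?thesis
      unfolding eq using norm_triangle_mono[OF 1 2] assms(4)
      by (simp add: field_simps power2_eq_square)
  qed
  ultimately show ?thesis
    unfolding calm_at_def by blast
qed

text \<open>An added real coordinate places \<open>S\<close> in a hyperplane, hence in a negligible
  set, while the dimension still does not exceed that of the target; the local bounds then keep the
  image negligible.\<close>

lemma negligible_calm_image_lowdim:
  fixes f :: "'a::euclidean_space \<Rightarrow> 'b::euclidean_space"
  assumes "DIM('a) < DIM('b)" and "\<And>x. x \<in> S \<Longrightarrow> calm_at f x"
  shows "negligible (f ` S)"
proof -
  define S' where "S' = S \<times> {0::real}"
  have "negligible {z::'a \<times> real. z \<bullet> (0, 1) = 0}"
    by (rule negligible_standard_hyperplane) (simp add: Basis_prod_def)
  then have "negligible S'"
    by (rule negligible_subset) (auto simp: S'_def)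
  moreover have "\<exists>T B. open T \<and> z \<in> T \<and> (\<forall>w \<in> S' \<inter> T. norm ((f \<circ> fst) w - (f \<circ> fst) z) \<le> B * norm (w - z))"
    if "z \<in> S'" for z
  proof -
    have "calm_at f (fst z)"
      using assms(2) that by (auto simp: S'_def)
    then obtain T B where "open T" "fst z \<in> T" "\<And>y. y \<in> T \<Longrightarrow> norm (f y - f (fst z)) \<le> B * norm (y - fst z)"
      unfolding calm_at_def by blast
    moreover have "norm (w - z) = norm (fst w - fst z)" if "w \<in> S'" for w
      using that \<open>z \<in> S'\<close> by (auto simp: S'_def)
    ultimately show ?thesis
      by (intro exI[of _ "T \<times> UNIV"] exI[of _ B]) (auto simp: open_Times mem_Times_iff)
  qed
  ultimately have "negligible ((f \<circ> fst) ` S')"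
    by (intro negligible_locally_Lipschitz_image) (use assms(1) in auto)
  moreover have "(f \<circ> fst) ` S' = f ` S"
    by (force simp: S'_def)
  ultimately show ?thesis by simp
qed

text \<open>
  Up to the normalising sum, the extension averages the values at those points of a dense sequence
  in the closed set that are at most twice as far away as the set itself.
\<close>

definition whitney_weight :: "'a::metric_space set \<Rightarrow> (nat \<Rightarrow> 'a) \<Rightarrow> nat \<Rightarrow> 'a \<Rightarrow> real" where
  "whitney_weight A y j x = (1 / 2) ^ j * max 0 (2 * infdist x A - dist x (y j))"

definition whitney_sum ::
    "'a::metric_space set \<Rightarrow> (nat \<Rightarrow> 'a) \<Rightarrow> (nat \<Rightarrow> 'b::real_normed_vector) \<Rightarrow> 'a \<Rightarrow> 'b" where
  "whitney_sum A y h x = (\<Sum>j. whitney_weight A y j x *\<^sub>R h j)"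

lemma whitney_weight_nonneg: "0 \<le> whitney_weight A y j x"
  by (simp add: whitney_weight_def)

lemma whitney_weight_le: "whitney_weight A y j x \<le> (1 / 2) ^ j * (2 * infdist x A)"
  unfolding whitney_weight_def by (intro mult_left_mono) (auto simp: infdist_nonneg)

text \<open>Both distances are 1-Lipschitz in the point, so the doubled one and the single one give
  3; cutting off at 0 does not increase it.\<close>

lemma whitney_weight_diff_le:
  "\<bar>whitney_weight A y j x - whitney_weight A y j x'\<bar> \<le> (1 / 2) ^ j * (3 * dist x x')"
proof -
  have "\<bar>max 0 (2 * infdist x A - dist x (y j)) - max 0 (2 * infdist x' A - dist x' (y j))\<bar> \<le> 3 * dist x x'"
    using infdist_triangle_abs[of x A x'] dist_triangle[of x "y j" x'] dist_triangle[of x' "y j" x]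
    unfolding dist_commute[of x' x] by linarith
  then show ?thesis
    unfolding whitney_weight_def by (simp add: abs_mult flip: right_diff_distrib)
qed

lemma summable_half_power: "summable (\<lambda>j. (1 / 2) ^ j * c :: real)"
  by (intro summable_mult2 summable_geometric) simp

lemma suminf_half_power: "(\<Sum>j. (1 / 2) ^ j * c :: real) = 2 * c"
  by (subst suminf_mult2[symmetric]) (auto simp: suminf_geometric intro: summable_geometric)

context
  fixes A :: "'a::euclidean_space set" and y :: "nat \<Rightarrow> 'a"
    and h :: "nat \<Rightarrow> 'b::euclidean_space" and M :: real
  assumes h: "\<And>j. norm (h j) \<le> M"
begin

lemma norm_whitney_le:
  "norm (whitney_weight A y j x *\<^sub>R h j) \<le> (1 / 2) ^ j * (2 * infdist x A * M)"
proof -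
  have "norm (whitney_weight A y j x *\<^sub>R h j) \<le> (1 / 2) ^ j * (2 * infdist x A) * M"
    unfolding norm_scaleR using whitney_weight_le[of A y j x] whitney_weight_nonneg[of A y j x] h
    by (intro mult_mono) (auto simp: infdist_nonneg)
  then show ?thesis
    by (simp add: mult.assoc)
qed

lemma summable_whitney: "summable (\<lambda>j. whitney_weight A y j x *\<^sub>R h j)"
  using summable_comparison_test'[OF summable_half_power norm_whitney_le] .

lemma norm_whitney_sum_le: "norm (whitney_sum A y h x) \<le> 4 * infdist x A * M"
  using norm_suminf_le[OF norm_whitney_le[of _ x] summable_half_power]
  unfolding suminf_half_power whitney_sum_def by (simp add: mult_ac)

text \<open>The geometric series doubles the termwise constant 3. The bound holds on the whole
  space, across the boundary of \<open>A\<close> included.\<close>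

lemma norm_whitney_sum_diff_le:
  "norm (whitney_sum A y h x - whitney_sum A y h x') \<le> 6 * M * norm (x - x')"
proof -
  have M: "0 \<le> M"
    using h[of 0] norm_ge_zero order_trans by blast
  have "norm (whitney_weight A y j x *\<^sub>R h j - whitney_weight A y j x' *\<^sub>R h j)
      \<le> (1 / 2) ^ j * (3 * dist x x' * M)" for j
  proof -
    have "norm (whitney_weight A y j x *\<^sub>R h j - whitney_weight A y j x' *\<^sub>R h j)
        \<le> (1 / 2) ^ j * (3 * dist x x') * M"
      unfolding scaleR_left_diff_distrib[symmetric] norm_scaleR
      using whitney_weight_diff_le[of A y j x x'] h M by (intro mult_mono) auto
    then show ?thesis
      by (simp add: mult.assoc)
  qed
  from norm_suminf_le[OF this summable_half_power]
  show ?thesis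
    unfolding suminf_half_power whitney_sum_def suminf_diff[OF summable_whitney summable_whitney]
    by (simp add: dist_norm mult_ac)
qed

lemma continuous_on_whitney_sum: "continuous_on UNIV (whitney_sum A y h)"
proof -
  have M: "0 \<le> M"
    using h[of 0] norm_ge_zero order_trans by blast
  have "(6 * M)-lipschitz_on UNIV (whitney_sum A y h)"
    using norm_whitney_sum_diff_le M by (intro lipschitz_onI) (auto simp: dist_norm)
  then show ?thesis
    by (rule lipschitz_on_continuous_on)
qed

lemma calm_at_whitney_sum: "calm_at (whitney_sum A y h) x"
  unfolding calm_at_def using norm_whitney_sum_diff_le by (intro exI[of _ UNIV]) auto

end

text \<open>
  Subtracting a multiple of the weight moves the extension off zero, because the multiples that fail
  form the image of a locally Lipschitz map into a space of larger dimension.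
\<close>

lemma nonvanishing_extension:
  fixes A :: "'a::euclidean_space set" and g :: "'a \<Rightarrow> 'b::euclidean_space"
  assumes "compact A" and contg: "continuous_on A g" and dim: "DIM('a) < DIM('b)"
  obtains G where "continuous_on UNIV G" "\<And>x. x \<in> A \<Longrightarrow> G x = g x" "\<And>x. x \<notin> A \<Longrightarrow> G x \<noteq> 0"
proof (cases "A = {}")
  case True
  obtain b :: 'b where "b \<in> Basis"
    using nonempty_Basis by blast
  then show ?thesis
    using that[of "\<lambda>_. b"] True nonzero_Basis by auto
next
  case False
  obtain Y where Y: "countable Y" "Y \<subseteq> A" "A \<subseteq> closure Y"
    using separable by metis
  have "Y \<noteq> {}"
    using Y False by auto
  define y where "y = from_nat_into Y"
  have range_y: "range y = Y"
    unfolding y_def using Y \<open>Y \<noteq> {}\<close> by (intro range_from_nat_into)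
  have yA: "y j \<in> A" for j
    using range_y Y by auto
  have "closed A"
    using \<open>compact A\<close> by (rule compact_imp_closed)
  obtain M where M: "\<And>x. x \<in> A \<Longrightarrow> norm (g x) \<le> M"
    using compact_imp_bounded[OF compact_continuous_image[OF contg \<open>compact A\<close>]]
    by (auto simp: bounded_iff)
  \<comment> \<open>\<open>W\<close> is the sum of the weights and \<open>N\<close> the weighted sum
    of the values; \<open>N x /\<^sub>R W x\<close> is the average.\<close>
  define W where "W = whitney_sum A y (\<lambda>_. 1::real)"
  define N where "N = whitney_sum A y (\<lambda>j. g (y j))"
  have one: "norm (1::real) \<le> 1" and gM: "norm (g (y j)) \<le> M" for j
    using M yA by auto
  have contW: "continuous_on UNIV W" and calmW: "calm_at W x" for x
    unfolding W_def using continuous_on_whitney_sum[OF one] calm_at_whitney_sum[OF one] by auto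
  have contN: "continuous_on UNIV N" and calmN: "calm_at N x" for x
    unfolding N_def using continuous_on_whitney_sum[OF gM] calm_at_whitney_sum[OF gM] by auto
  have Wle: "\<bar>W x\<bar> \<le> 4 * infdist x A" for x
    using norm_whitney_sum_le[OF one, of A y x] by (simp add: W_def)
  have Wpos: "W x > 0" if "x \<notin> A" for x
  proof -
    have d: "infdist x A > 0"
      using that \<open>closed A\<close> False by (simp add: infdist_pos_not_in_closed)
    obtain a where a: "a \<in> A" "infdist x A = dist x a"
      using infdist_attains_inf[OF \<open>closed A\<close> False] by metis
    \<comment> \<open>The nearest point \<open>a\<close> need not belong to the sequence; the factor
      2 in the weight leaves room for a \<open>y j\<close> close to it.\<close>
    obtain j where "dist (y j) a < infdist x A"
      using Y(3) a d range_y unfolding closure_approachable by (metis imageE subsetD closure_approachable)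
    then have "dist x (y j) < 2 * infdist x A"
      using a dist_triangle[of x "y j" a] by (simp add: dist_commute)
    then have "0 < whitney_weight A y j x *\<^sub>R (1::real)"
      by (simp add: whitney_weight_def)
    then show ?thesis
      unfolding W_def whitney_sum_def
      using summable_whitney[of "\<lambda>_. 1::real" 1 A y x] whitney_weight_nonneg[of A y]
      by (intro suminf_pos2[of _ j]) auto
  qed
  \<comment> \<open>A weighted mean stays in every closed ball that contains all values of positive
    weight.\<close>
  have avg: "norm (N x /\<^sub>R W x - z) \<le> e"
    if "x \<notin> A" and e: "\<And>j. dist x (y j) < 2 * infdist x A \<Longrightarrow> norm (g (y j) - z) \<le> e" for x z e
  proof -
    have sN: "summable (\<lambda>j. whitney_weight A y j x *\<^sub>R g (y j))"
      using summable_whitney[OF gM] .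
    have s1: "summable (\<lambda>j. whitney_weight A y j x)"
      using summable_whitney[OF one, of A y x] by simp
    have "N x - W x *\<^sub>R z = (\<Sum>j. whitney_weight A y j x *\<^sub>R g (y j) - whitney_weight A y j x *\<^sub>R z)"
      unfolding N_def W_def whitney_sum_def
      using suminf_diff[OF sN summable_scaleR_left[OF s1, of z]] suminf_scaleR_left[OF s1, of z]
      by simp
    also have "norm \<dots> \<le> (\<Sum>j. whitney_weight A y j x * e)"
    proof (rule norm_suminf_le)
      fix j
      show "norm (whitney_weight A y j x *\<^sub>R g (y j) - whitney_weight A y j x *\<^sub>R z)
          \<le> whitney_weight A y j x * e"
      proof (cases "dist x (y j) < 2 * infdist x A")
        case True
        then show ?thesis
          unfolding scaleR_diff_right[symmetric] norm_scaleR
          using e[OF True] whitney_weight_nonneg[of A y j x] by (auto intro: mult_left_mono)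
      next
        case False
        then show ?thesis
          by (simp add: whitney_weight_def)
      qed
    qed (intro summable_mult2 s1)
    also have "\<dots> = W x * e"
      using suminf_mult2[OF s1, of e] by (simp add: W_def whitney_sum_def)
    finally have le: "norm (N x - W x *\<^sub>R z) \<le> W x * e" .
    have "N x /\<^sub>R W x - z = (N x - W x *\<^sub>R z) /\<^sub>R W x"
      using Wpos[OF \<open>x \<notin> A\<close>] by (simp add: scaleR_diff_right)
    then have "norm (N x /\<^sub>R W x - z) = norm (N x - W x *\<^sub>R z) / W x"
      using Wpos[OF \<open>x \<notin> A\<close>] by (simp add: divide_inverse mult.commute)
    then show ?thesis
      using le Wpos[OF \<open>x \<notin> A\<close>] by (simp add: pos_divide_le_eq mult.commute)
  qed
  \<comment> \<open>One division by \<open>W x\<close> normalises, the other solves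
    \<open>N x /\<^sub>R W x = W x *\<^sub>R c\<close> for \<open>c\<close>.\<close>
  have "negligible ((\<lambda>x. (N x /\<^sub>R W x) /\<^sub>R W x) ` (- A))"
    using dim by (intro negligible_calm_image_lowdim calm_at_divide calmN calmW contW) (auto intro: Wpos)
  then obtain c where c: "c \<notin> (\<lambda>x. (N x /\<^sub>R W x) /\<^sub>R W x) ` (- A)"
    using non_negligible_UNIV by (metis UNIV_eq_I)
  define G where "G x = (if x \<in> A then g x else N x /\<^sub>R W x - W x *\<^sub>R c)" for x
  have "G x \<noteq> 0" if "x \<notin> A" for x
  proof
    assume "G x = 0"
    then have "c = (N x /\<^sub>R W x) /\<^sub>R W x"
      using that Wpos[OF that] by (simp add: G_def)
    then show False
      using c that by blast
  qed
  moreover have "continuous (at x) G" for x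
  proof (cases "x \<in> A")
    case False
    have "continuous_on (- A) (\<lambda>x. N x /\<^sub>R W x - W x *\<^sub>R c)"
      using Wpos by (intro continuous_intros continuous_on_subset[OF contN] continuous_on_subset[OF contW])
        (auto simp: less_le)
    then have "continuous_on (- A) G"
      by (rule continuous_on_eq) (auto simp: G_def)
    then show ?thesis
      using False \<open>closed A\<close> by (simp add: continuous_on_eq_continuous_at open_Compl)
  next
    case True
    show ?thesis
      unfolding continuous_at_eps_delta
    proof (intro allI impI)
      fix e :: real assume "e > 0"
      obtain d where d: "d > 0" "\<And>x'. x' \<in> A \<Longrightarrow> dist x' x < d \<Longrightarrow> dist (g x') (g x) < e / 2"
        using contg True \<open>e > 0\<close> unfolding continuous_on_iff by (metis half_gt_zero)
      \<comment> \<open>The sequence points with positive weight at \<open>x'\<close> lie within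
        \<open>3 * r\<close> of \<open>x\<close>, whence \<open>d / 3\<close>. As
        \<open>W x'\<close> is below \<open>4 * r\<close>, the other bound keeps the correction
        below \<open>e / 2\<close>; the \<open>+ 1\<close> covers \<open>c = 0\<close>.\<close>
      define r where "r = min (d / 3) (e / (8 * (norm c + 1)))"
      have r: "r > 0"
        using d \<open>e > 0\<close> by (auto simp: r_def intro!: divide_pos_pos add_nonneg_pos)
      have "dist (G x') (G x) < e" if x': "dist x' x < r" for x'
      proof (cases "x' \<in> A")
        case True
        have "dist x' x < d"
          using x' d by (simp add: r_def)
        then show ?thesis
          using d(2)[OF True] True \<open>x \<in> A\<close> \<open>e > 0\<close> by (auto simp: G_def)
      next
        case False
        have inf: "infdist x' A \<le> dist x' x"
          using \<open>x \<in> A\<close> by (rule infdist_le)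
        have "norm (N x' /\<^sub>R W x' - g x) \<le> e / 2"
        proof (rule avg[OF False])
          fix j assume "dist x' (y j) < 2 * infdist x' A"
          then have "dist (y j) x < 3 * r"
            using inf x' dist_triangle[of "y j" x x'] by (simp add: dist_commute)
          then have "dist (y j) x < d"
            by (simp add: r_def)
          then show "norm (g (y j) - g x) \<le> e / 2"
            using d(2)[OF yA] by (auto simp: dist_norm intro: less_imp_le)
        qed
        moreover have "norm (W x' *\<^sub>R c) < e / 2"
        proof -
          have "norm (W x' *\<^sub>R c) \<le> (4 * dist x' x) * (norm c + 1)"
            unfolding norm_scaleR using Wle[of x'] inf by (intro mult_mono) auto
          also have "\<dots> < (4 * r) * (norm c + 1)"
            using x' by (intro mult_strict_right_mono) (auto intro: add_nonneg_pos)
          also have "\<dots> \<le> (4 * (e / (8 * (norm c + 1)))) * (norm c + 1)"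
            by (intro mult_right_mono mult_left_mono) (auto simp: r_def)
          also have "\<dots> = e / 2"
            using norm_ge_zero[of c] by (simp add: field_simps add_nonneg_eq_0_iff)
          finally show ?thesis .
        qed
        moreover have "G x' - G x = (N x' /\<^sub>R W x' - g x) - W x' *\<^sub>R c"
          using False \<open>x \<in> A\<close> by (simp add: G_def)
        ultimately show ?thesis
          unfolding dist_norm using norm_triangle_ineq4[of "N x' /\<^sub>R W x' - g x" "W x' *\<^sub>R c"] by simp
      qed
      then show "\<exists>d>0. \<forall>x'. dist x' x < d \<longrightarrow> dist (G x') (G x) < e"
        using r by blast
    qed
  qed
  then have "continuous_on UNIV G"
    by (simp add: continuous_at_imp_continuous_on)
  moreover have "G x = g x" if "x \<in> A" for x
    using that by (simp add: G_def)
  ultimately show ?thesis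
    using that by blast
qed


section \<open>Quaternions and the level set\<close>

instantiation quat :: euclidean_space
begin

definition Basis_quat :: "quat set" where
  "Basis = {Quat 1 0 0 0, Quat 0 1 0 0, Quat 0 0 1 0, Quat 0 0 0 1}"

instance
proof
  fix u v x :: quat
  show "(Basis :: quat set) \<noteq> {}" "finite (Basis :: quat set)"
    by (simp_all add: Basis_quat_def)
  show "u \<bullet> v = (if u = v then 1 else 0)" if "u \<in> Basis" "v \<in> Basis"
    using that unfolding Basis_quat_def by (elim insertE emptyE) (simp_all add: inner_quat_def)
  show "(\<forall>u\<in>Basis. x \<bullet> u = 0) \<longleftrightarrow> x = 0"
    by (simp add: Basis_quat_def inner_quat_def) (simp add: quat_eq_iff)
qed

end

lemma scaleR_norm_sgn: "norm x *\<^sub>R sgn x = (x :: 'a::real_normed_vector)"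
  by (cases "x = 0") (simp_all add: sgn_div_norm del: inverse_eq_divide)

lemma DIM_quat: "DIM(quat) = 4"
  by (simp add: Basis_quat_def)

text \<open>The quaternion conjugate; with the real part written as an inner product, its continuity
  is immediate.\<close>

definition qcnj :: "quat \<Rightarrow> quat" where
  "qcnj q = (2 * (q \<bullet> 1)) *\<^sub>R 1 - q"

lemma mult_qcnj: "q * qcnj q = (norm q)\<^sup>2 *\<^sub>R 1"
proof -
  have "(norm q)\<^sup>2 = qRe q * qRe q + qI q * qI q + qJ q * qJ q + qK q * qK q"
    by (simp add: norm_quat_def power2_eq_square)
  then show ?thesis
    by (simp add: qcnj_def quat_eq_iff inner_quat_def)
qed

lemma continuous_on_qcnj [continuous_intros]:
  assumes "continuous_on S f"
  shows "continuous_on S (\<lambda>x. qcnj (f x))"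
  unfolding qcnj_def by (intro continuous_intros assms)

lemma continuous_on_vector_smult:
  fixes a :: "'a::topological_space \<Rightarrow> quat" and q :: "'a \<Rightarrow> quat ^ 'n::finite"
  assumes "continuous_on S a" "continuous_on S q"
  shows "continuous_on S (\<lambda>x. a x *s q x)"
  unfolding vector_scalar_mult_def by (intro continuous_on_vec_lambda continuous_on_mult continuous_on_component assms)

section \<open>The polytope of squared moduli\<close>

definition squared_moduli :: "quat ^ 'n \<Rightarrow> real ^ 'n" where
  "squared_moduli q = (\<chi> i. (norm (q $ i))\<^sup>2)"

text \<open>The image of \<open>Z_H \<Lambda>\<close> under \<open>squared_moduli\<close>: a point
  \<open>r\<close> comes from the real vector with entries \<open>sqrt (r $ i)\<close>.\<close>

definition moment_polytope :: "('n::finite \<Rightarrow> real ^ 'd) \<Rightarrow> (real ^ 'n) set" where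
  "moment_polytope \<Lambda> = {r. (\<forall>i. 0 \<le> r $ i) \<and> (\<Sum>i\<in>UNIV. r $ i *\<^sub>R \<Lambda> i) = 0 \<and> (\<Sum>i\<in>UNIV. r $ i) = 1}"

lemma Z_H_iff: "q \<in> Z_H \<Lambda> \<longleftrightarrow> squared_moduli q \<in> moment_polytope \<Lambda>"
  by (simp add: Z_H_def squared_moduli_def moment_polytope_def)

lemma linear_weighted_sum: "linear (\<lambda>r :: real ^ 'n::finite. \<Sum>i\<in>UNIV. r $ i *\<^sub>R \<Lambda> i)"
  by (rule linearI) (simp_all add: scaleR_left_distrib sum.distrib scaleR_sum_right)

lemma convex_standard_simplex:
  "convex {r :: real ^ 'n::finite. (\<forall>i. 0 \<le> r $ i) \<and> (\<Sum>i\<in>UNIV. r $ i) = 1}"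
proof (rule convexI)
  fix x y :: "real ^ 'n" and u v :: real
  assume "x \<in> {r. (\<forall>i. 0 \<le> r $ i) \<and> (\<Sum>i\<in>UNIV. r $ i) = 1}"
    and "y \<in> {r. (\<forall>i. 0 \<le> r $ i) \<and> (\<Sum>i\<in>UNIV. r $ i) = 1}"
    and uv: "0 \<le> u" "0 \<le> v" "u + v = 1"
  moreover have "(\<Sum>i\<in>UNIV. (u *\<^sub>R x + v *\<^sub>R y) $ i) = u * (\<Sum>i\<in>UNIV. x $ i) + v * (\<Sum>i\<in>UNIV. y $ i)"
    by (simp add: sum.distrib sum_distrib_left)
  ultimately show "u *\<^sub>R x + v *\<^sub>R y \<in> {r. (\<forall>i. 0 \<le> r $ i) \<and> (\<Sum>i\<in>UNIV. r $ i) = 1}"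
    by simp
qed

lemma moment_polytope_eq:
  "moment_polytope \<Lambda> = {r. (\<forall>i. 0 \<le> r $ i) \<and> (\<Sum>i\<in>UNIV. r $ i) = 1}
     \<inter> (\<lambda>r. \<Sum>i\<in>UNIV. r $ i *\<^sub>R \<Lambda> i) -` {0}"
  by (auto simp: moment_polytope_def)

lemma convex_moment_polytope: "convex (moment_polytope \<Lambda>)"
  unfolding moment_polytope_eq
  by (intro convex_Int convex_standard_simplex convex_linear_vimage linear_weighted_sum convex_singleton)

text \<open>The weighted sums over the simplex form a convex set containing each
  \<open>\<Lambda> i\<close> as the image of a vertex, hence the whole hull. Weighting indices
  instead of vectors allows for repeated \<open>\<Lambda> i\<close>.\<close>

lemma moment_polytope_nonempty:
  fixes \<Lambda> :: "'n::finite \<Rightarrow> real ^ 'd"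
  assumes "0 \<in> convex hull (range \<Lambda>)"
  shows "moment_polytope \<Lambda> \<noteq> {}"
proof -
  let ?S = "{r :: real ^ 'n. (\<forall>i. 0 \<le> r $ i) \<and> (\<Sum>i\<in>UNIV. r $ i) = 1}"
  let ?L = "\<lambda>r :: real ^ 'n. \<Sum>i\<in>UNIV. r $ i *\<^sub>R \<Lambda> i"
  have "\<Lambda> i \<in> ?L ` ?S" for i
  proof (rule image_eqI)
    have "?L (axis i 1) = (\<Sum>j\<in>UNIV. if j = i then \<Lambda> j else 0)"
      by (rule sum.cong) (auto simp: axis_def)
    then show "\<Lambda> i = ?L (axis i 1)"
      by simp
  qed (simp add: axis_def)
  then have "range \<Lambda> \<subseteq> ?L ` ?S"
    by (rule image_subsetI)
  then have "convex hull (range \<Lambda>) \<subseteq> ?L ` ?S"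
    by (intro hull_minimal convex_linear_image linear_weighted_sum convex_standard_simplex)
  then show ?thesis
    using assms unfolding moment_polytope_eq by (auto 4 3)
qed

text \<open>
  The extended phases are undefined at most at points of \<open>A\<close>, where the modulus vanishes, so
  moduli and phases fit together continuously.
\<close>

lemma Z_H_extension:
  fixes A :: "'a::euclidean_space set" and g :: "'a \<Rightarrow> quat ^ 'n::finite"
  assumes dim: "DIM('a) \<le> 3" and "compact A" and contg: "continuous_on A g"
    and gZ: "g ` A \<subseteq> Z_H \<Lambda>" and ne: "moment_polytope \<Lambda> \<noteq> {}"
  obtains G where "continuous_on UNIV G" "range G \<subseteq> Z_H \<Lambda>" "\<And>x. x \<in> A \<Longrightarrow> G x = g x"
proof -
  have "continuous_on A (\<lambda>x. squared_moduli (g x))"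
    unfolding squared_moduli_def using contg by (intro continuous_intros)
  moreover have "(\<lambda>x. squared_moduli (g x)) ` A \<subseteq> moment_polytope \<Lambda>"
    using gZ Z_H_iff by auto
  moreover have "closedin (top_of_set UNIV) A"
    using \<open>compact A\<close> by (simp add: compact_imp_closed)
  \<comment> \<open>Convexity of the polytope lets Dugundji's theorem extend the moduli without
    leaving it.\<close>
  ultimately obtain v where contv: "continuous_on UNIV v" and vP: "v ` UNIV \<subseteq> moment_polytope \<Lambda>"
    and vA: "\<And>x. x \<in> A \<Longrightarrow> v x = squared_moduli (g x)"
    using Dugundji[OF convex_moment_polytope ne] by blast
  have v0: "0 \<le> v x $ i" for x i
    using vP by (auto simp: moment_polytope_def)
  have "\<exists>G. continuous_on UNIV G \<and> (\<forall>x\<in>A. G x = g x $ i) \<and> (\<forall>x. x \<notin> A \<longrightarrow> G x \<noteq> 0)" for i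
  proof -
    have "continuous_on A (\<lambda>x. g x $ i)"
      using contg by (intro continuous_intros)
    from nonvanishing_extension[OF \<open>compact A\<close> this] dim show ?thesis
      unfolding DIM_quat by (metis le_imp_less_Suc Suc_numeral semiring_norm(2,8))
  qed
  then obtain G where contG: "\<And>i. continuous_on UNIV (G i)"
    and GA: "\<And>i x. x \<in> A \<Longrightarrow> G i x = g x $ i" and G0: "\<And>i x. x \<notin> A \<Longrightarrow> G i x \<noteq> 0"
    by metis
  define F where "F x = (\<chi> i. sqrt (v x $ i) *\<^sub>R sgn (G i x))" for x
  \<comment> \<open>A zero of \<open>G i\<close> lies in \<open>A\<close>, where
    \<open>G i x\<close> is a coordinate of \<open>g x\<close> and \<open>v x $ i\<close> its
    squared modulus.\<close>
  have vG: "v x $ i = 0" if "G i x = 0" for i x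
    using that G0 GA vA by (metis norm_zero power_zero_numeral squared_moduli_def vec_lambda_beta)
  have "squared_moduli (F x) = v x" for x
    using v0 vG by (simp add: squared_moduli_def F_def vec_eq_iff power_mult_distrib norm_sgn)
  then have "range F \<subseteq> Z_H \<Lambda>"
    using vP by (auto simp: Z_H_iff)
  moreover have "F x = g x" if "x \<in> A" for x
    using that by (simp add: F_def vA GA squared_moduli_def vec_eq_iff scaleR_norm_sgn)
  moreover have "isCont (\<lambda>x. sqrt (v x $ i) *\<^sub>R sgn (G i x)) x" for i x
  proof (cases "G i x = 0")
    case False
    then show ?thesis
      using contv contG[of i] by (intro continuous_intros) (auto simp: continuous_on_eq_continuous_at)
  next
    case True
    \<comment> \<open>\<open>sgn\<close> jumps at 0 but is bounded by 1, so the vanishing modulus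
      squeezes the product to 0.\<close>
    have "isCont (\<lambda>x. sqrt (v x $ i)) x"
      using contv by (intro continuous_intros) (auto simp: continuous_on_eq_continuous_at)
    then have "(\<lambda>y. sqrt (v y $ i)) \<midarrow>x\<rightarrow> 0"
      using vG[OF True] by (simp add: isCont_def)
    then have "(\<lambda>y. sqrt (v y $ i) *\<^sub>R sgn (G i y)) \<midarrow>x\<rightarrow> 0"
      by (rule Lim_null_comparison[rotated]) (auto simp: norm_sgn v0)
    then show ?thesis
      using True by (simp add: isCont_def)
  qed
  then have "continuous_on UNIV F"
    unfolding F_def by (intro continuous_on_vec_lambda continuous_at_imp_continuous_on ballI)
  ultimately show ?thesis
    by (intro that[of F]) auto
qed

text \<open>The values on \<open>A\<close> are units and the extension has no zeros off
  \<open>A\<close>, so it can be normalised by \<open>sgn\<close>.\<close>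

lemma Sp1_extension:
  fixes A :: "'a::euclidean_space set" and g :: "'a \<Rightarrow> quat"
  assumes "DIM('a) \<le> 3" and "compact A" and "continuous_on A g" and "g ` A \<subseteq> Sp1"
  obtains G where "continuous_on UNIV G" "range G \<subseteq> Sp1" "\<And>x. x \<in> A \<Longrightarrow> G x = g x"
proof -
  have "DIM('a) < DIM(quat)"
    using assms(1) by (simp add: DIM_quat)
  then obtain G where G: "continuous_on UNIV G" "\<And>x. x \<in> A \<Longrightarrow> G x = g x" "\<And>x. x \<notin> A \<Longrightarrow> G x \<noteq> 0"
    using nonvanishing_extension[OF assms(2,3)] by metis
  have "G x \<noteq> 0" for x
    using G(2,3)[of x] assms(4) by (cases "x \<in> A") (auto simp: Sp1_def)
  then have "continuous_on UNIV (\<lambda>x. sgn (G x))" "range (\<lambda>x. sgn (G x)) \<subseteq> Sp1"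
    using G(1) by (auto intro!: continuous_intros simp: Sp1_def norm_sgn)
  moreover have "sgn (G x) = g x" if "x \<in> A" for x
    using G(2)[OF that] assms(4) that by (auto simp: Sp1_def sgn_div_norm)
  ultimately show ?thesis
    by (rule that)
qed

text \<open>Two points are a map on the compact set \<open>{0, 1}\<close>, whose extension to the
  line restricts to a path.\<close>

lemma path_connected_Z_H:
  assumes "moment_polytope \<Lambda> \<noteq> {}"
  shows "path_connected (Z_H \<Lambda>)"
  unfolding path_connected_def
proof (intro ballI)
  fix p q assume pq: "p \<in> Z_H \<Lambda>" "q \<in> Z_H \<Lambda>"
  obtain G :: "real \<Rightarrow> _" where "continuous_on UNIV G" "range G \<subseteq> Z_H \<Lambda>"
    and "\<And>x. x \<in> {0, 1} \<Longrightarrow> G x = (if x = 0 then p else q)"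
    by (rule Z_H_extension[of "{0, 1::real}" "\<lambda>x. if x = 0 then p else q" \<Lambda>])
      (use pq assms in \<open>auto simp: continuous_on_finite\<close>)
  then show "\<exists>g. path g \<and> path_image g \<subseteq> Z_H \<Lambda> \<and> pathstart g = p \<and> pathfinish g = q"
    by (intro exI[of _ G])
      (auto simp: path_def path_image_def pathstart_def pathfinish_def intro: continuous_on_subset)
qed


section \<open>Lifting maps to the level set\<close>

lemma Sp1_mult: "a \<in> Sp1 \<Longrightarrow> b \<in> Sp1 \<Longrightarrow> a * b \<in> Sp1"
  by (simp add: Sp1_def norm_mult)

lemma Sp1_inverse: "a \<in> Sp1 \<Longrightarrow> inverse a \<in> Sp1"
  by (simp add: Sp1_def norm_inverse)

lemma Sp1_nonzero: "a \<in> Sp1 \<Longrightarrow> a \<noteq> 0"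
  by (auto simp: Sp1_def)

lemma Sp1_orbit_smult:
  assumes "a \<in> Sp1"
  shows "Sp1_orbit (a *s q) = Sp1_orbit q"
proof -
  have "Sp1_orbit (b *s p) \<subseteq> Sp1_orbit p" if "b \<in> Sp1" for b and p :: "quat ^ 'a"
    using that by (auto simp: Sp1_orbit_def vector_smult_assoc intro: Sp1_mult)
  from this[OF assms, of q] this[OF Sp1_inverse[OF assms], of "a *s q"] show ?thesis
    by (simp add: vector_smult_assoc Sp1_nonzero[OF assms])
qed

lemma Sp1_orbit_eq_iff: "Sp1_orbit p = Sp1_orbit q \<longleftrightarrow> (\<exists>a\<in>Sp1. p = a *s q)"
proof
  have "1 *s p \<in> Sp1_orbit p"
    unfolding Sp1_orbit_def by (auto simp: Sp1_def intro!: exI[of _ 1])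
  then show "\<exists>a\<in>Sp1. p = a *s q" if "Sp1_orbit p = Sp1_orbit q"
    using that by (auto simp: Sp1_orbit_def)
qed (auto simp: Sp1_orbit_smult)

lemma Z_H_smult: "a \<in> Sp1 \<Longrightarrow> q \<in> Z_H \<Lambda> \<Longrightarrow> a *s q \<in> Z_H \<Lambda>"
  by (simp add: Z_H_def Sp1_def norm_mult)

section \<open>Comparing points of one orbit\<close>

definition transition :: "quat ^ 'n::finite \<Rightarrow> quat ^ 'n \<Rightarrow> quat" where
  "transition p q = (\<Sum>i\<in>UNIV. p $ i * qcnj (q $ i))"

text \<open>Each coordinate contributes \<open>a\<close> times its squared norm, and these norms add
  up to 1. So a pairing continuous in both points recovers the group element between them.\<close>

lemma transition_smult:
  assumes "q \<in> Z_H \<Lambda>"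
  shows "transition (a *s q) q = a"
proof -
  have "transition (a *s q) q = (\<Sum>i\<in>UNIV. (norm (q $ i))\<^sup>2 *\<^sub>R a)"
    by (simp add: transition_def mult.assoc mult_qcnj)
  also have "\<dots> = a"
    using assms by (simp add: Z_H_def flip: scaleR_left.sum)
  finally show ?thesis .
qed

lemma
  assumes "q \<in> Z_H \<Lambda>" "Sp1_orbit p = Sp1_orbit q"
  shows transition_in_Sp1: "transition p q \<in> Sp1" and transition_smult_eq: "transition p q *s q = p"
  using assms(2) transition_smult[OF assms(1)] by (auto simp: Sp1_orbit_eq_iff)

lemma continuous_on_transition:
  assumes "continuous_on S p" "continuous_on S q"
  shows "continuous_on S (\<lambda>x. transition (p x) (q x))"
  unfolding transition_def by (intro continuous_intros assms)

lemma topspace_N_H: "topspace (N_H \<Lambda>) = Sp1_orbit ` Z_H \<Lambda>"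
  by (simp add: N_H_def topspace_quotient_topology)

lemma quotient_map_Sp1_orbit: "quotient_map (top_of_set (Z_H \<Lambda>)) (N_H \<Lambda>) Sp1_orbit"
  by (simp add: N_H_def quotient_map_quotient_topology)

lemma continuous_map_Sp1_orbit: "continuous_map (top_of_set (Z_H \<Lambda>)) (N_H \<Lambda>) Sp1_orbit"
  by (rule quotient_imp_continuous_map[OF quotient_map_Sp1_orbit])

text \<open>
  Where the \<open>i\<close>-th coordinate is nonzero, each orbit has a unique representative in which this
  coordinate is a positive real.
\<close>

lemma N_H_local_section:
  assumes "x \<in> topspace (N_H \<Lambda>)"
  obtains U \<sigma> where "openin (N_H \<Lambda>) U" "x \<in> U"
    "continuous_map (subtopology (N_H \<Lambda>) U) (top_of_set (Z_H \<Lambda>)) \<sigma>"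
    "\<And>u. u \<in> U \<Longrightarrow> Sp1_orbit (\<sigma> u) = u"
proof -
  obtain q0 where q0: "q0 \<in> Z_H \<Lambda>" "x = Sp1_orbit q0"
    using assms topspace_N_H by blast
  then have "(\<Sum>i\<in>UNIV. (norm (q0 $ i))\<^sup>2) \<noteq> 0"
    by (simp add: Z_H_def)
  then obtain i where i: "q0 $ i \<noteq> 0"
    by (auto elim: sum.not_neutral_contains_not_neutral)
  define V where "V = {q \<in> Z_H \<Lambda>. q $ i \<noteq> 0}"
  define U where "U = Sp1_orbit ` V"
  define s where "s q = inverse (sgn (q $ i)) *s q" for q :: "quat ^ 'a"
  define \<sigma> where "\<sigma> u = s (SOME q. q \<in> V \<and> Sp1_orbit q = u)" for u
  have sgnV: "inverse (sgn (q $ i)) \<in> Sp1" if "q \<in> V" for q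
    using that by (auto simp: V_def Sp1_def norm_inverse norm_sgn)
  \<comment> \<open>\<open>V\<close> is saturated, because multiplication by a unit preserves the
    vanishing of a coordinate; hence \<open>U\<close> is open when \<open>V\<close> is.\<close>
  have preim: "{q \<in> topspace (top_of_set (Z_H \<Lambda>)). Sp1_orbit q \<in> U} = V"
    by (auto simp: U_def V_def Sp1_orbit_eq_iff Sp1_nonzero)
  have "open {q :: quat ^ 'a. q $ i \<noteq> 0}"
    by (intro open_Collect_neq continuous_intros)
  then have "openin (top_of_set (Z_H \<Lambda>)) V"
    unfolding V_def openin_open by (intro exI[of _ "{q. q $ i \<noteq> 0}"]) auto
  moreover have "U \<subseteq> topspace (N_H \<Lambda>)"
    by (auto simp: U_def V_def topspace_N_H)
  ultimately have opU: "openin (N_H \<Lambda>) U"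
    unfolding N_H_def openin_quotient_topology preim by (simp add: topspace_quotient_topology)
  \<comment> \<open>The phase of \<open>a * q $ i\<close> is \<open>a\<close> times that of
    \<open>q $ i\<close>, so \<open>a\<close> cancels. At a zero coordinate \<open>sgn 0 = 0\<close>
    and \<open>inverse 0 = 0\<close> make both sides 0.\<close>
  have s_inv: "s (a *s q) = s q" if "a \<in> Sp1" for a q
  proof -
    have "sgn (a * p) = a * sgn p" for p
      using that by (simp add: Sp1_def sgn_div_norm norm_mult)
    then show ?thesis
      using that by (cases "q $ i = 0")
        (simp_all add: s_def vector_smult_assoc nonzero_inverse_mult_distrib Sp1_nonzero mult.assoc sgn_zero_iff)
  qed
  have \<sigma>s: "\<sigma> (Sp1_orbit q) = s q" if "q \<in> V" for q
  proof -
    have "(SOME p. p \<in> V \<and> Sp1_orbit p = Sp1_orbit q) \<in> V \<and>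
        Sp1_orbit (SOME p. p \<in> V \<and> Sp1_orbit p = Sp1_orbit q) = Sp1_orbit q"
      by (rule someI[of _ q]) (use that in auto)
    then show ?thesis
      unfolding \<sigma>_def Sp1_orbit_eq_iff using s_inv by metis
  qed
  \<comment> \<open>Over the open set \<open>U\<close> the projection is still a quotient map, so
    \<open>\<sigma>\<close> is continuous as soon as \<open>\<sigma> \<circ> Sp1_orbit\<close> is,
    which equals \<open>s\<close> on \<open>V\<close>.\<close>
  have "quotient_map (subtopology (top_of_set (Z_H \<Lambda>)) V) (subtopology (N_H \<Lambda>) U) Sp1_orbit"
    using quotient_map_restriction[OF quotient_map_Sp1_orbit preim] opU by blast
  moreover have "continuous_map (subtopology (top_of_set (Z_H \<Lambda>)) V) (top_of_set (Z_H \<Lambda>)) (\<sigma> \<circ> Sp1_orbit)"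
  proof (rule continuous_map_eq)
    have VZ: "Z_H \<Lambda> \<inter> V = V"
      by (auto simp: V_def)
    have "continuous_on V (\<lambda>q. inverse (sgn (q $ i)))"
      by (intro continuous_intros) (auto simp: V_def sgn_zero_iff)
    then have "continuous_on V s"
      unfolding s_def by (intro continuous_on_vector_smult continuous_on_id)
    moreover have "s ` V \<subseteq> Z_H \<Lambda>"
      using sgnV by (auto simp: s_def V_def intro!: Z_H_smult)
    ultimately show "continuous_map (subtopology (top_of_set (Z_H \<Lambda>)) V) (top_of_set (Z_H \<Lambda>)) s"
      by (auto simp: subtopology_subtopology VZ continuous_map_in_subtopology)
  qed (auto simp: \<sigma>s)
  ultimately have "continuous_map (subtopology (N_H \<Lambda>) U) (top_of_set (Z_H \<Lambda>)) \<sigma>"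
    by (rule continuous_compose_quotient_map)
  moreover have "Sp1_orbit (\<sigma> u) = u" if "u \<in> U" for u
    using that sgnV by (auto simp: U_def \<sigma>s s_def Sp1_orbit_smult)
  moreover have "x \<in> U"
    using q0 i by (auto simp: U_def V_def)
  ultimately show ?thesis
    using that opU by blast
qed

section \<open>Lifts over balls and rectangles\<close>

definition lifts_on :: "('n::finite \<Rightarrow> real ^ 'd) \<Rightarrow> ('a::topological_space \<Rightarrow> (quat ^ 'n) set) \<Rightarrow> 'a set \<Rightarrow> bool" where
  "lifts_on \<Lambda> f S \<longleftrightarrow>
     (\<exists>F. continuous_on S F \<and> F ` S \<subseteq> Z_H \<Lambda> \<and> (\<forall>t\<in>S. Sp1_orbit (F t) = f t))"

lemma lifts_on_subset: "lifts_on \<Lambda> f T \<Longrightarrow> S \<subseteq> T \<Longrightarrow> lifts_on \<Lambda> f S"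
  unfolding lifts_on_def by (meson continuous_on_subset image_mono order_trans subsetD)

lemma lifts_on_ball:
  fixes f :: "'a::metric_space \<Rightarrow> (quat ^ 'n::finite) set"
  assumes "continuous_map euclidean (N_H \<Lambda>) f"
  obtains e where "e > 0" "lifts_on \<Lambda> f (ball t e)"
proof -
  have "f t \<in> topspace (N_H \<Lambda>)"
    using continuous_map_image_subset_topspace[OF assms] by auto
  then obtain U \<sigma> where U: "openin (N_H \<Lambda>) U" "f t \<in> U"
    and \<sigma>: "continuous_map (subtopology (N_H \<Lambda>) U) (top_of_set (Z_H \<Lambda>)) \<sigma>"
    and \<sigma>U: "\<And>u. u \<in> U \<Longrightarrow> Sp1_orbit (\<sigma> u) = u"
    using N_H_local_section by metis
  have "open {s. f s \<in> U}"
    using openin_continuous_map_preimage[OF assms U(1)] by simp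
  then obtain e where e: "e > 0" "ball t e \<subseteq> {s. f s \<in> U}"
    using U(2) by (auto simp: open_contains_ball)
  have "continuous_map (top_of_set (ball t e)) (subtopology (N_H \<Lambda>) U) f"
    using e(2) by (auto simp: continuous_map_in_subtopology intro: continuous_map_from_subtopology[OF assms])
  then have "continuous_map (top_of_set (ball t e)) (top_of_set (Z_H \<Lambda>)) (\<sigma> \<circ> f)"
    using \<sigma> by (rule continuous_map_compose)
  then have "lifts_on \<Lambda> f (ball t e)"
    unfolding lifts_on_def using e(2) \<sigma>U
    by (intro exI[of _ "\<sigma> \<circ> f"]) (auto simp: continuous_map_in_subtopology)
  then show ?thesis
    using that e(1) by blast
qed

text \<open>
  The two lifts differ over \<open>S \<inter> T\<close> by a continuous \<open>Sp(1)\<close>-valued function, which the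
  retraction extends to \<open>T\<close>, where it corrects the second lift.
\<close>

lemma lifts_on_Un:
  assumes "lifts_on \<Lambda> f S" "lifts_on \<Lambda> f T" "closed S" "closed T"
    and cont\<rho>: "continuous_on T \<rho>" and \<rho>: "\<rho> ` T \<subseteq> S \<inter> T" "\<And>t. t \<in> S \<inter> T \<Longrightarrow> \<rho> t = t"
  shows "lifts_on \<Lambda> f (S \<union> T)"
proof -
  obtain F where F: "continuous_on S F" "F ` S \<subseteq> Z_H \<Lambda>" "\<And>t. t \<in> S \<Longrightarrow> Sp1_orbit (F t) = f t"
    using assms(1) by (auto simp: lifts_on_def)
  obtain G where G: "continuous_on T G" "G ` T \<subseteq> Z_H \<Lambda>" "\<And>t. t \<in> T \<Longrightarrow> Sp1_orbit (G t) = f t"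
    using assms(2) by (auto simp: lifts_on_def)
  define c where "c t = transition (F (\<rho> t)) (G (\<rho> t))" for t
  have c: "c t \<in> Sp1" "c t *s G (\<rho> t) = F (\<rho> t)" if "t \<in> T" for t
  proof -
    have "\<rho> t \<in> S" "\<rho> t \<in> T"
      using \<rho>(1) that by auto
    then have "G (\<rho> t) \<in> Z_H \<Lambda>" "Sp1_orbit (F (\<rho> t)) = Sp1_orbit (G (\<rho> t))"
      using F(3) G(2,3) by auto
    then show "c t \<in> Sp1" "c t *s G (\<rho> t) = F (\<rho> t)"
      unfolding c_def by (rule transition_in_Sp1, rule transition_smult_eq)
  qed
  have "continuous_on T (\<lambda>t. F (\<rho> t))" "continuous_on T (\<lambda>t. G (\<rho> t))"
    using \<rho>(1) by (auto intro: continuous_on_compose2[OF F(1) cont\<rho>] continuous_on_compose2[OF G(1) cont\<rho>])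
  then have "continuous_on T (\<lambda>t. c t *s G t)"
    unfolding c_def by (intro continuous_on_vector_smult continuous_on_transition G(1))
  moreover have "F t = c t *s G t" if "t \<in> S" "t \<in> T" for t
    using c(2)[of t] \<rho>(2)[of t] that by simp
  ultimately have "continuous_on (S \<union> T) (\<lambda>t. if t \<in> S then F t else c t *s G t)"
    using assms(3,4) F(1) by (intro continuous_on_cases) auto
  moreover have "(if t \<in> S then F t else c t *s G t) \<in> Z_H \<Lambda> \<and>
      Sp1_orbit (if t \<in> S then F t else c t *s G t) = f t" if "t \<in> S \<union> T" for t
    using that F(2,3) G(2,3) c(1) by (auto simp: Sp1_orbit_smult intro!: Z_H_smult)
  ultimately show ?thesis
    unfolding lifts_on_def
    by (intro exI[of _ "\<lambda>t. if t \<in> S then F t else c t *s G t"] conjI image_subsetI ballI) blast+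
qed

text \<open>Bisection in the second coordinate gives lifts over thin strips, bisection in the first
  joins the strips. Rectangles with a common edge glue because projection onto that edge is a
  retraction.\<close>

lemma lifts_on_rectangle:
  fixes f :: "real \<times> real \<Rightarrow> (quat ^ 'n::finite) set"
  assumes f: "continuous_map euclidean (N_H \<Lambda>) f" and "a \<le> b" "c \<le> d"
  shows "lifts_on \<Lambda> f ({a..b} \<times> {c..d})"
  using \<open>a \<le> b\<close>
proof (induction rule: Bolzano)
  case (trans u v w)
  have "{u..w} \<times> {c..d} = {u..v} \<times> {c..d} \<union> {v..w} \<times> {c..d}"
    using trans by auto
  moreover have "lifts_on \<Lambda> f ({u..v} \<times> {c..d} \<union> {v..w} \<times> {c..d})"
    by (rule lifts_on_Un[OF trans(1,2), where \<rho> = "\<lambda>t. (v, snd t)"])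
      (use trans(3,4) in \<open>auto simp: closed_Times intro!: continuous_on_Pair continuous_on_snd continuous_on_const continuous_on_id\<close>)
  ultimately show ?case
    by simp
next
  case (local x)
  \<comment> \<open>The half-width \<open>r\<close> is left existential so that joining two pieces
    of a strip can pass to the smaller one.\<close>
  have "\<exists>r>0. lifts_on \<Lambda> f ({x - r..x + r} \<times> {c..d})"
    using \<open>c \<le> d\<close>
  proof (induction rule: Bolzano)
    case (trans u v w)
    then obtain r r' where r: "r > 0" "lifts_on \<Lambda> f ({x - r..x + r} \<times> {u..v})"
      and r': "r' > 0" "lifts_on \<Lambda> f ({x - r'..x + r'} \<times> {v..w})"
      by auto
    define k where "k = min r r'"
    have k: "k > 0" "lifts_on \<Lambda> f ({x - k..x + k} \<times> {u..v})" "lifts_on \<Lambda> f ({x - k..x + k} \<times> {v..w})"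
    proof -
      show "k > 0"
        using r(1) r'(1) by (simp add: k_def)
      show "lifts_on \<Lambda> f ({x - k..x + k} \<times> {u..v})"
        by (rule lifts_on_subset[OF r(2)]) (auto simp: k_def)
      show "lifts_on \<Lambda> f ({x - k..x + k} \<times> {v..w})"
        by (rule lifts_on_subset[OF r'(2)]) (auto simp: k_def)
    qed
    have "{x - k..x + k} \<times> {u..w} = {x - k..x + k} \<times> {u..v} \<union> {x - k..x + k} \<times> {v..w}"
      using trans by auto
    moreover have "lifts_on \<Lambda> f ({x - k..x + k} \<times> {u..v} \<union> {x - k..x + k} \<times> {v..w})"
      by (rule lifts_on_Un[OF k(2,3), where \<rho> = "\<lambda>t. (fst t, v)"])
        (use trans(3,4) in \<open>auto simp: closed_Times intro!: continuous_on_Pair continuous_on_fst continuous_on_const continuous_on_id\<close>)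
    ultimately have "lifts_on \<Lambda> f ({x - k..x + k} \<times> {u..w})"
      by simp
    then show ?case
      using k(1) by blast
  next
    case (local z)
    obtain e where e: "e > 0" "lifts_on \<Lambda> f (ball (x, z) e)"
      using lifts_on_ball[OF f] by metis
    \<comment> \<open>Deviations of at most \<open>e / 3\<close> in each coordinate add up to less
      than \<open>e\<close>.\<close>
    have "{x - e / 3..x + e / 3} \<times> {u..v} \<subseteq> ball (x, z) e" if "u \<le> z" "z \<le> v" "v - u < e / 3" for u v
    proof
      fix t assume t: "t \<in> {x - e / 3..x + e / 3} \<times> {u..v}"
      have "dist (x, z) t \<le> dist x (fst t) + dist z (snd t)"
        by (cases t) (simp add: dist_Pair_Pair sqrt_sum_squares_le_sum)
      also have "\<dots> < e"
        using t that e(1) by (auto simp: dist_real_def)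
      finally show "t \<in> ball (x, z) e"
        by simp
    qed
    then have "\<exists>r>0. lifts_on \<Lambda> f ({x - r..x + r} \<times> {u..v})" if "u \<le> z" "z \<le> v" "v - u < e / 3" for u v
      using that e lifts_on_subset by (intro exI[of _ "e / 3"]) fastforce
    then show ?case
      using e(1) by (intro exI[of _ "e / 3"]) auto
  qed
  then obtain r where r: "r > 0" "lifts_on \<Lambda> f ({x - r..x + r} \<times> {c..d})"
    by blast
  then have "lifts_on \<Lambda> f ({u..v} \<times> {c..d})" if "u \<le> x" "x \<le> v" "v - u < r" for u v
    using that by (intro lifts_on_subset[OF r(2)]) auto
  then show ?case
    using r(1) by blast
qed


section \<open>Contracting maps of cubes\<close>

lemma topspace_cube: "topspace (cube k) = (\<Pi>\<^sub>E i\<in>{..<k}. {0..1})"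
  by (simp add: cube_def)

lemma cube_coordinate: "t \<in> topspace (cube k) \<Longrightarrow> i < k \<Longrightarrow> t i \<in> {0..1}"
  using PiE_mem[of t "{..<k}" "\<lambda>_. {0..1::real}" i] by (simp add: topspace_cube)

text \<open>
  Cubes of dimension 1 and 2 are both compared with the unit square; for \<open>k = 1\<close> the second
  coordinate is ignored.
\<close>

definition to_square :: "nat \<Rightarrow> (nat \<Rightarrow> real) \<Rightarrow> real \<times> real" where
  "to_square k t = (t 0, if 1 < k then t 1 else 0)"

text \<open>Clamping extends a left inverse of \<open>to_square\<close> to the whole plane, so that
  composites with it are globally continuous; the restriction makes the result extensional, as
  points of \<open>cube k\<close> are.\<close>

definition of_square :: "nat \<Rightarrow> real \<times> real \<Rightarrow> nat \<Rightarrow> real" where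
  "of_square k z = (\<lambda>i\<in>{..<k}. max 0 (min 1 (if i = 0 then fst z else snd z)))"

lemma continuous_map_to_square:
  assumes "k > 0"
  shows "continuous_map (cube k) euclidean (to_square k)"
proof -
  have coord: "continuous_map (cube k) euclidean (\<lambda>t. t i)" if "i < k" for i
  proof -
    have "continuous_map (cube k) (top_of_set {0..1}) (\<lambda>t. t i)"
      unfolding cube_def using that by (intro continuous_map_product_coordinates) auto
    then show ?thesis
      by (simp add: continuous_map_in_subtopology)
  qed
  have "continuous_map (cube k) (prod_topology euclidean euclidean) (to_square k)"
    unfolding continuous_map_pairwise to_square_def o_def
    using assms coord by (cases "1 < k") auto
  then show ?thesis
    by simp
qed

lemma continuous_map_of_square: "continuous_map euclidean (cube k) (of_square k)"
proof -
  have "continuous_on UNIV (\<lambda>z :: real \<times> real. if i = 0 then fst z else snd z)" for i :: nat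
    by (cases "i = 0") (auto intro: continuous_intros)
  then show ?thesis
    unfolding cube_def continuous_map_componentwise of_square_def
    by (auto simp: continuous_map_in_subtopology intro!: continuous_on_max continuous_on_min)
qed

lemma of_square_to_square:
  assumes "k \<in> {1..2}" "t \<in> topspace (cube k)"
  shows "of_square k (to_square k t) = t"
proof
  fix i
  show "of_square k (to_square k t) i = t i"
  proof (cases "i < k")
    case True
    then have "0 \<le> t i" "t i \<le> 1"
      using cube_coordinate[OF assms(2)] by auto
    moreover have "i = 0 \<or> i = 1 \<and> 1 < k"
      using True assms(1) by auto
    ultimately show ?thesis
      using True by (auto simp: of_square_def to_square_def)
  next
    \<comment> \<open>Outside \<open>{..<k}\<close> both functions are
      \<open>undefined\<close>.\<close>
    case False
    then show ?thesis
      using False PiE_arb[OF assms(2)[unfolded topspace_cube], of i] by (simp add: of_square_def restrict_apply)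
  qed
qed

lemma to_square_mem:
  assumes "k \<in> {1..2}" "t \<in> topspace (cube k)"
  shows "to_square k t \<in> {0..1} \<times> {0..1}"
  using assms(1) cube_coordinate[OF assms(2), of 0] cube_coordinate[OF assms(2), of 1]
  by (auto simp: to_square_def)

text \<open>For \<open>k = 1\<close> only the two vertical edges lie over the endpoints of the
  interval.\<close>

definition square_boundary :: "nat \<Rightarrow> (real \<times> real) set" where
  "square_boundary k = {0, 1} \<times> {0..1} \<union> (if 1 < k then {0..1} \<times> {0, 1} else {})"

lemma compact_square_boundary: "compact (square_boundary k)"
  by (auto simp: square_boundary_def intro!: compact_Un compact_Times)

lemma square_boundary_subset: "square_boundary k \<subseteq> {0..1} \<times> {0..1}"
  by (auto simp: square_boundary_def)

lemma to_square_boundary: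
  assumes "k \<in> {1..2}" "t \<in> cube_boundary k"
  shows "to_square k t \<in> square_boundary k"
proof -
  have t: "t \<in> topspace (cube k)"
    using assms(2) by (simp add: cube_boundary_def)
  obtain i where "i < k" "t i = 0 \<or> t i = 1"
    using assms(2) by (auto simp: cube_boundary_def)
  moreover from \<open>i < k\<close> have "i = 0 \<or> i = 1 \<and> 1 < k"
    using assms(1) by auto
  ultimately show ?thesis
    using to_square_mem[OF assms(1) t] by (auto simp: to_square_def square_boundary_def)
qed

lemma of_square_boundary:
  assumes "k > 0" "z \<in> square_boundary k"
  shows "of_square k z \<in> cube_boundary k"
proof -
  have "of_square k z \<in> topspace (cube k)"
    using continuous_map_image_subset_topspace[OF continuous_map_of_square[of k]] by auto
  moreover have "\<exists>i<k. of_square k z i = 0 \<or> of_square k z i = 1"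
  proof (cases "fst z \<in> {0, 1}")
    case True
    then show ?thesis
      using assms(1) by (intro exI[of _ 0]) (auto simp: of_square_def)
  next
    case False
    then have "1 < k" "snd z \<in> {0, 1}"
      using assms(2) by (auto simp: square_boundary_def split: if_splits)
    then show ?thesis
      by (intro exI[of _ 1]) (auto simp: of_square_def)
  qed
  ultimately show ?thesis
    by (simp add: cube_boundary_def)
qed

text \<open>
  On the boundary a lift differs from a constant by an \<open>Sp(1)\<close>-valued function, which extends
  over the square because \<open>Sp(1)\<close> is a 3-sphere; dividing by it makes the lift constant there.
\<close>

lemma based_lift:
  fixes f :: "real \<times> real \<Rightarrow> (quat ^ 'n::finite) set"
  assumes f: "continuous_map euclidean (N_H \<Lambda>) f" and q: "q \<in> Z_H \<Lambda>"
    and B: "compact B" "B \<subseteq> {0..1} \<times> {0..1}" "\<And>z. z \<in> B \<Longrightarrow> f z = Sp1_orbit q"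
  obtains F where "continuous_on ({0..1} \<times> {0..1}) F" "F ` ({0..1} \<times> {0..1}) \<subseteq> Z_H \<Lambda>"
    "\<And>z. z \<in> {0..1} \<times> {0..1} \<Longrightarrow> Sp1_orbit (F z) = f z" "\<And>z. z \<in> B \<Longrightarrow> F z = q"
proof -
  let ?Q = "{0..1} \<times> {0..1} :: (real \<times> real) set"
  obtain F where F: "continuous_on ?Q F" "F ` ?Q \<subseteq> Z_H \<Lambda>" "\<And>z. z \<in> ?Q \<Longrightarrow> Sp1_orbit (F z) = f z"
    using lifts_on_rectangle[OF f, of 0 1 0 1] by (auto simp: lifts_on_def)
  have orbit: "Sp1_orbit (F z) = Sp1_orbit q" if "z \<in> B" for z
    using that B(2,3) F(3) by auto
  have "continuous_on B (\<lambda>z. transition (F z) q)"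
    by (intro continuous_on_transition continuous_on_subset[OF F(1) B(2)] continuous_on_const)
  moreover have "(\<lambda>z. transition (F z) q) ` B \<subseteq> Sp1"
    using transition_in_Sp1[OF q orbit] by blast
  moreover have "DIM(real \<times> real) \<le> 3"
    by simp
  ultimately obtain c where c: "continuous_on UNIV c" "range c \<subseteq> Sp1" "\<And>z. z \<in> B \<Longrightarrow> c z = transition (F z) q"
    using Sp1_extension[OF _ B(1)] by blast
  have cS: "c z \<in> Sp1" for z
    using c(2) by auto
  define G where "G z = inverse (c z) *s F z" for z
  have "continuous_on ?Q (\<lambda>z. inverse (c z))"
    using Sp1_nonzero[OF cS] by (intro continuous_on_inverse continuous_on_subset[OF c(1)]) auto
  then have "continuous_on ?Q G"
    unfolding G_def by (intro continuous_on_vector_smult F(1))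
  moreover have "G ` ?Q \<subseteq> Z_H \<Lambda>"
    using F(2) by (auto simp: G_def intro!: Z_H_smult Sp1_inverse cS)
  moreover have "Sp1_orbit (G z) = f z" if "z \<in> ?Q" for z
    using F(3)[OF that] by (simp add: G_def Sp1_orbit_smult Sp1_inverse cS)
  moreover have "G z = q" if "z \<in> B" for z
  proof -
    have "F z = c z *s q"
      using transition_smult_eq[OF q orbit[OF that]] c(3)[OF that] by simp
    then show ?thesis
      by (simp add: G_def vector_smult_assoc Sp1_nonzero[OF cS])
  qed
  ultimately show ?thesis
    using that by blast
qed

text \<open>A box of dimension 3 carries the based lift on its bottom and the constant
  \<open>q\<close> on its top and on the sides over the boundary. This extends into
  \<open>Z_H \<Lambda>\<close> over the box, and the orbit projection of the extension is the
  homotopy.\<close>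

lemma based_map_null_homotopic:
  fixes \<Lambda> :: "'n::finite \<Rightarrow> real ^ 'd"
  assumes k: "k \<in> {1..2}" and x: "x \<in> topspace (N_H \<Lambda>)" and f: "f \<in> based_maps k (N_H \<Lambda>) x"
  shows "homotopic_with (\<lambda>h. \<forall>t\<in>cube_boundary k. h t = x) (cube k) (N_H \<Lambda>) f (\<lambda>_. x)"
proof -
  let ?Q = "{0..1} \<times> {0..1} :: (real \<times> real) set" and ?B = "square_boundary k"
  obtain q where q: "q \<in> Z_H \<Lambda>" "x = Sp1_orbit q"
    using x topspace_N_H by blast
  have ne: "moment_polytope \<Lambda> \<noteq> {}"
    using q(1) by (auto simp: Z_H_iff)
  have contf: "continuous_map (cube k) (N_H \<Lambda>) f" and fx: "\<And>t. t \<in> cube_boundary k \<Longrightarrow> f t = x"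
    using f by (auto simp: based_maps_def)
  have "continuous_map euclidean (N_H \<Lambda>) (f \<circ> of_square k)"
    using continuous_map_of_square contf by (rule continuous_map_compose)
  moreover have "(f \<circ> of_square k) z = Sp1_orbit q" if "z \<in> ?B" for z
    using fx[OF of_square_boundary[OF _ that]] k q(2) by auto
  ultimately obtain F where F: "continuous_on ?Q F" "F ` ?Q \<subseteq> Z_H \<Lambda>"
    "\<And>z. z \<in> ?Q \<Longrightarrow> Sp1_orbit (F z) = (f \<circ> of_square k) z" "\<And>z. z \<in> ?B \<Longrightarrow> F z = q"
    using based_lift[OF _ q(1) compact_square_boundary square_boundary_subset] by blast
  \<comment> \<open>Bottom, then top and sides, with time as the last coordinate. The pieces meet in
    \<open>?B\<close> at time 0, where \<open>F\<close> equals \<open>q\<close>, so \<open>g\<close>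
    is continuous.\<close>
  let ?A0 = "?Q \<times> {0::real}" and ?A1 = "?Q \<times> {1::real} \<union> ?B \<times> {0..1}"
  define g where "g p = (if p \<in> ?A0 then F (fst p) else q)" for p
  have "continuous_on ?A0 (\<lambda>p. F (fst p))"
    by (intro continuous_on_compose2[OF F(1)] continuous_intros) auto
  then have "continuous_on (?A0 \<union> ?A1) g"
    unfolding g_def using F(4)
    by (intro continuous_on_cases continuous_on_const)
      (auto intro!: closed_Un closed_Times compact_imp_closed[OF compact_square_boundary])
  moreover have "g ` (?A0 \<union> ?A1) \<subseteq> Z_H \<Lambda>"
    using F(2) q(1) by (auto simp: g_def)
  moreover have "compact (?A0 \<union> ?A1)"
    by (intro compact_Un compact_Times compact_square_boundary) auto
  moreover have "DIM((real \<times> real) \<times> real) \<le> 3"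
    by simp
  ultimately obtain G where G: "continuous_on UNIV G" "range G \<subseteq> Z_H \<Lambda>"
    "\<And>p. p \<in> ?A0 \<union> ?A1 \<Longrightarrow> G p = g p"
    using Z_H_extension[OF _ _ _ _ ne] by blast
  define h where "h p = Sp1_orbit (G (to_square k (snd p), fst p))" for p :: "real \<times> (nat \<Rightarrow> real)"
  have Gx: "Sp1_orbit (G (z, s)) = x" if "(z, s) \<in> ?A1" for z s
    using that G(3)[of "(z, s)"] F(4) q(2) by (auto simp: g_def)
  show ?thesis
  \<comment> \<open>The boundary condition depends only on values in the cube, so endpoints of the
    homotopy need to agree only there.\<close>
  proof (subst homotopic_with, force simp: cube_boundary_def, intro exI conjI ballI)
    have "continuous_map (prod_topology (top_of_set {0..1}) (cube k)) (prod_topology euclidean euclidean)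
        (\<lambda>p. (to_square k (snd p), fst p))"
      using k unfolding continuous_map_pairwise o_def
      by (auto intro!: continuous_map_compose[OF continuous_map_snd continuous_map_to_square, unfolded o_def]
          continuous_map_into_fulltopology[OF continuous_map_fst])
    moreover have "continuous_map euclidean (top_of_set (Z_H \<Lambda>)) G"
      using G(1,2) by (auto simp: continuous_map_in_subtopology)
    ultimately show "continuous_map (prod_topology (top_of_set {0..1}) (cube k)) (N_H \<Lambda>) h"
      using continuous_map_compose[OF continuous_map_compose continuous_map_Sp1_orbit]
      unfolding h_def o_def by fastforce
    show "h (0, t) = f t" if "t \<in> topspace (cube k)" for t
      using to_square_mem[OF k that] of_square_to_square[OF k that] G(3)[of "(to_square k t, 0)"]
        F(3)[of "to_square k t"] by (simp add: h_def g_def)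
    show "h (1, t) = x" if "t \<in> topspace (cube k)" for t
      using to_square_mem[OF k that] by (simp add: h_def Gx)
    show "h (s, t) = x" if "s \<in> {0..1}" "t \<in> cube_boundary k" for s t
      using to_square_boundary[OF k that(2)] that(1) by (simp add: h_def Gx)
  qed
qed

text \<open>Through the constant map any two based maps are homotopic, so the only class is the set
  of all of them, nonempty by the constant map itself.\<close>

lemma is_singleton_homotopy_group_set:
  assumes "x \<in> topspace X"
    and null: "\<And>f. f \<in> based_maps k X x \<Longrightarrow>
      homotopic_with (\<lambda>h. \<forall>t\<in>cube_boundary k. h t = x) (cube k) X f (\<lambda>_. x)"
  shows "is_singleton (homotopy_group_set k X x)"
proof -
  let ?R = "{(f, g). f \<in> based_maps k X x \<and> g \<in> based_maps k X x \<and>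
      homotopic_with (\<lambda>h. \<forall>t\<in>cube_boundary k. h t = x) (cube k) X f g}"
  have "(\<lambda>_. x) \<in> based_maps k X x"
    using assms(1) by (simp add: based_maps_def)
  moreover have "?R = based_maps k X x \<times> based_maps k X x"
    using null by (auto intro: homotopic_with_trans homotopic_with_symD)
  ultimately have "homotopy_group_set k X x = {based_maps k X x}"
    unfolding homotopy_group_set_def by (auto simp: quotient_def)
  then show ?thesis
    by simp
qed

theorem theorem8p1:
  fixes m :: nat and \<Lambda> :: "'n::finite \<Rightarrow> real ^ 'd"
  assumes "m \<ge> 1"
    and "CARD('d) = 4 * m"
    and "admissible m \<Lambda>"
    and "affine hull (range \<Lambda>) = UNIV"
  shows "n_connected_space 2 (N_H \<Lambda>)"
proof -
  have ne: "moment_polytope \<Lambda> \<noteq> {}"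
    using assms(3) by (intro moment_polytope_nonempty) (simp add: admissible_def)
  \<comment> \<open>Extending the map on the empty set produces a point of
    \<open>Z_H \<Lambda>\<close>.\<close>
  obtain G :: "real \<Rightarrow> quat ^ 'n" where "range G \<subseteq> Z_H \<Lambda>"
    by (rule Z_H_extension[of "{}::real set" undefined \<Lambda>]) (use ne in auto)
  then have "topspace (N_H \<Lambda>) \<noteq> {}"
    by (auto simp: topspace_N_H)
  moreover have "path_connected_space (N_H \<Lambda>)"
    using path_connected_space_quotient_map_image[OF quotient_map_Sp1_orbit] path_connected_Z_H[OF ne]
    by (simp add: path_connected_space_euclidean_subtopology)
  ultimately show ?thesis
    unfolding n_connected_space_def
    by (intro conjI ballI is_singleton_homotopy_group_set based_map_null_homotopic) auto
qed

end
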